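(* For all real constants $C, L_0, \alpha_0$ there exists a constant $K>0$, depending only on $C$, $L_0$ and $\alpha_0$ (in particular not on $n$), such that the following holds. Let $d, n \ge 1$ be integers, let $0 < \varepsilon \le 1$, let $\gamma : [a_0,b_0] \subset \mathbb{R} \to \mathbb{R}^d$ be the natural (arc-length) parameterization of a regular $C^1$ curve, and let $f_1,\dots,f_n : \mathbb{R}^d \to \mathbb{R}^d$ be $C^{1+\varepsilon}$ maps that are invertible with continuously differentiable inverses $f_i^{-1}:\mathbb{R}^d\to\mathbb{R}^d$. Put $F_0 = \mathrm{id}$ and $F_i = f_i \circ f_{i-1} \circ \cdots \circ f_1$ for $1 \le i \le n$. Assume that $$\|f_i\|_1 \le C,\quad \|f_i^{-1}\|_1 \le C,\quad \|Df_i\|_{\varepsilon} \le C \qquad \text{for all } 1 \le i \le n,$$ and that $$\sum_{i=0}^{n-1} L(F_i \circ \gamma)^{\varepsilon} \le L_0, \qquad \sum_{i=0}^{n-1} \alpha(F_i \circ \gamma) \le \alpha_0 .$$ Then for any $x, y \in [a_0,b_0]$, $$K^{-1} \le \frac{\|(F_n \circ \gamma)'(x)\|}{\|(F_n \circ \gamma)'(y)\|} \le K .$$ Moreover, with the same $K$, for any two (nondegenerate) subintervals $[a_1,b_1], [a_2,b_2] \subset [a_0,b_0]$, $$\frac{|b_1-a_1|}{|b_2-a_2|}\, K^{-2} \le \frac{L((F_n\circ\gamma)([a_1,b_1]))}{L((F_n\circ\gamma)([a_2,b_2]))} \le \frac{|b_1-a_1|}{|b_2-a_2|}\, K^{2}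.$$
   Context: A regular $C^1$ curve is a map $\gamma:[a,b]\subset\mathbb{R}\to\mathbb{R}^d$ whose derivative $\gamma'(t)$ is continuous and nowhere zero. Natural parameterization means parameterization by arc length, i.e. $\|\gamma'(t)\|=1$ for all $t$. $\|\cdot\|$ is the Euclidean norm on vectors and the induced operator norm on matrices. The length of a regular $C^1$ curve is $L(\gamma)=\int_a^b\|\gamma'(t)\|\,dt$, and its maximal angle is $\alpha(\gamma)=\sup_{x,y\in[a,b]}\angle(\gamma'(x),\gamma'(y))$, where $\angle(u,v)\in[0,\pi]$ is the angle between nonzero vectors $u,v$. For a subinterval $[a',b']$, $L((F_n\circ\gamma)([a',b']))$ denotes the length of the restriction of the curve $F_n\circ\gamma$ to $[a',b']$, i.e. $\int_{a'}^{b'}\|(F_n\circ\gamma)'(t)\|\,dt$. For a continuously differentiable $f:\mathbb{R}^p\to\mathbb{R}^m$, $D_xf$ is its Jacobian matrix (total derivative) at $x$; the $C^1$ seminorm is $\|f\|_1=\sup_{x,v\in\mathbb{R}^p,\ \|v\|=1}\|D_xf\cdot v\|$; for $0<\varepsilon\le1$ the $C^{1+\varepsilon}$ seminorm is $\|Df\|_\varepsilon=\sup_{x\neq y\in\mathbb{R}^p}\frac{\|D_xf-D_yf\|}{\|x-y\|^\varepsilon}$. One says $f\in C^{1+\varepsilon}$ if $f$ is continuously differentiable and $\|Df\|_\varepsilon<\infty$. *)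

theory Defs
  imports "HOL-Analysis.Analysis" "HOL-Library.Poly_Mapping"
begin

section \<open>Euclidean spaces of arbitrary dimension inside one type\<close>

text \<open>
  The distortion constant must not depend on the dimension, so the dimension has to be
  quantified inside the statement and cannot be a type. We therefore realize all spaces
  \<open>\<real>\<^sup>d\<close> as coordinate subspaces of the space of finitely supported real sequences
  \<open>nat \<Rightarrow>\<^sub>0 real\<close>, which is equipped with the standard inner product. Derivatives of maps
  on \<open>\<real>\<^sup>d\<close> are the library's derivatives within that subspace.
\<close>

instantiation poly_mapping :: (type, real_vector) real_vector
begin

lift_definition scaleR_poly_mapping :: "real \<Rightarrow> ('a \<Rightarrow>\<^sub>0 'b) \<Rightarrow> 'a \<Rightarrow>\<^sub>0 'b"
  is "\<lambda>r f k. r *\<^sub>R f k"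
  by (rule finite_subset[rotated]) auto

instance
  by standard (transfer; simp add: fun_eq_iff scaleR_add_right scaleR_add_left)+

end

lemma lookup_scaleR_poly_mapping:
  "Poly_Mapping.lookup (r *\<^sub>R x) k = r *\<^sub>R Poly_Mapping.lookup x k"
  by transfer simp

instantiation poly_mapping :: (type, real_inner) real_inner
begin

definition inner_poly_mapping :: "('a \<Rightarrow>\<^sub>0 'b) \<Rightarrow> ('a \<Rightarrow>\<^sub>0 'b) \<Rightarrow> real" where
  "inner_poly_mapping x y =
     (\<Sum>k\<in>Poly_Mapping.keys x. Poly_Mapping.lookup x k \<bullet> Poly_Mapping.lookup y k)"

definition norm_poly_mapping :: "('a \<Rightarrow>\<^sub>0 'b) \<Rightarrow> real" where
  "norm_poly_mapping x = sqrt (x \<bullet> x)"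

definition sgn_poly_mapping :: "('a \<Rightarrow>\<^sub>0 'b) \<Rightarrow> 'a \<Rightarrow>\<^sub>0 'b" where
  "sgn_poly_mapping x = x /\<^sub>R norm x"

definition dist_poly_mapping :: "('a \<Rightarrow>\<^sub>0 'b) \<Rightarrow> ('a \<Rightarrow>\<^sub>0 'b) \<Rightarrow> real" where
  "dist_poly_mapping x y = norm (x - y)"

definition uniformity_poly_mapping :: "(('a \<Rightarrow>\<^sub>0 'b) \<times> ('a \<Rightarrow>\<^sub>0 'b)) filter" where
  "uniformity_poly_mapping = (INF e\<in>{0<..}. principal {(x, y). dist x y < e})"

definition open_poly_mapping :: "('a \<Rightarrow>\<^sub>0 'b) set \<Rightarrow> bool" where
  "open_poly_mapping U \<longleftrightarrow> (\<forall>x\<in>U. \<forall>\<^sub>F (x', y) in uniformity. x' = x \<longrightarrow> y \<in> U)"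

lemma inner_poly_mapping_superset:
  fixes x y :: "'a \<Rightarrow>\<^sub>0 'b"
  assumes "finite A" "Poly_Mapping.keys x \<subseteq> A"
  shows "x \<bullet> y = (\<Sum>k\<in>A. Poly_Mapping.lookup x k \<bullet> Poly_Mapping.lookup y k)"
  unfolding inner_poly_mapping_def
  by (rule sum.mono_neutral_left) (use assms in \<open>auto simp: in_keys_iff\<close>)

instance
proof
  fix x y z :: "'a \<Rightarrow>\<^sub>0 'b" and r :: real
  show "sgn x = x /\<^sub>R norm x" "dist x y = norm (x - y)" "norm x = sqrt (x \<bullet> x)"
    by (fact sgn_poly_mapping_def dist_poly_mapping_def norm_poly_mapping_def)+
  show "(uniformity :: (('a \<Rightarrow>\<^sub>0 'b) \<times> ('a \<Rightarrow>\<^sub>0 'b)) filter) =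
      (INF e\<in>{0<..}. principal {(x, y). dist x y < e})"
    by (fact uniformity_poly_mapping_def)
  show "open U \<longleftrightarrow> (\<forall>x\<in>U. \<forall>\<^sub>F (x', y) in uniformity. x' = x \<longrightarrow> y \<in> U)"
    for U :: "('a \<Rightarrow>\<^sub>0 'b) set"
    by (fact open_poly_mapping_def)
  let ?A = "Poly_Mapping.keys x \<union> Poly_Mapping.keys y"
  have fin: "finite ?A" by simp
  show "x \<bullet> y = y \<bullet> x"
    by (simp add: inner_poly_mapping_superset[OF fin] inner_commute)
  have "Poly_Mapping.keys (x + y) \<subseteq> ?A"
    by (rule Poly_Mapping.keys_add)
  then show "(x + y) \<bullet> z = x \<bullet> z + y \<bullet> z"
    by (simp add: inner_poly_mapping_superset[OF fin] lookup_add inner_add_left sum.distrib)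
  have "Poly_Mapping.keys (r *\<^sub>R x) \<subseteq> Poly_Mapping.keys x"
    by (auto simp: in_keys_iff lookup_scaleR_poly_mapping)
  then show "(r *\<^sub>R x) \<bullet> y = r * (x \<bullet> y)"
    by (simp add: inner_poly_mapping_superset[of "Poly_Mapping.keys x"]
        lookup_scaleR_poly_mapping sum_distrib_left)
  show "0 \<le> x \<bullet> x"
    by (simp add: inner_poly_mapping_def sum_nonneg)
  show "x \<bullet> x = 0 \<longleftrightarrow> x = 0"
    by (auto simp: inner_poly_mapping_def sum_nonneg_eq_0_iff in_keys_iff
        intro!: poly_mapping_eqI)
qed

end

type_synonym rvec = "nat \<Rightarrow>\<^sub>0 real"

definition Rd :: "nat \<Rightarrow> rvec set" where
  "Rd d = {x. Poly_Mapping.keys x \<subseteq> {..<d}}"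

lemma subspace_Rd: "subspace (Rd d)"
  by (auto simp: subspace_def Rd_def in_keys_iff lookup_add lookup_scaleR_poly_mapping subset_iff)
    (metis add_0 add_cancel_right_right)

lemma inner_Rd:
  "x \<in> Rd d \<Longrightarrow> x \<bullet> y = (\<Sum>i<d. Poly_Mapping.lookup x i * Poly_Mapping.lookup y i)"
  unfolding Rd_def by (subst inner_poly_mapping_superset[of "{..<d}"]) auto

lemma norm_Rd: "x \<in> Rd d \<Longrightarrow> norm x = L2_set (Poly_Mapping.lookup x) {..<d}"
  by (simp add: norm_eq_sqrt_inner inner_Rd L2_set_def power2_eq_square)


section \<open>Derivatives and seminorms of maps on \<open>\<real>\<^sup>d\<close>\<close>

text \<open>
  The derivative within \<open>Rd d\<close> is determined only on vectors of \<open>Rd d\<close>, so it must only be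
  applied to such vectors. For this reason the operator norm below is taken over the unit
  sphere of \<open>Rd d\<close> (rather than using \<open>onorm\<close>). The suprema are extended reals, so that
  an unbounded supremum is \<open>\<infinity>\<close>.
\<close>

definition Dmap :: "nat \<Rightarrow> (rvec \<Rightarrow> rvec) \<Rightarrow> rvec \<Rightarrow> rvec \<Rightarrow> rvec" where
  "Dmap d f x = frechet_derivative f (at x within Rd d)"

definition op_norm :: "nat \<Rightarrow> (rvec \<Rightarrow> rvec) \<Rightarrow> ereal" where
  "op_norm d A = (SUP v\<in>{v \<in> Rd d. norm v = 1}. ereal (norm (A v)))"

definition C1_map :: "nat \<Rightarrow> (rvec \<Rightarrow> rvec) \<Rightarrow> bool" where
  "C1_map d f \<longleftrightarrow> f ` Rd d \<subseteq> Rd d \<and> f differentiable_on Rd d \<and>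
     (\<forall>x\<in>Rd d. ((\<lambda>y. op_norm d (\<lambda>v. Dmap d f y v - Dmap d f x v)) \<longlongrightarrow> 0) (at x within Rd d))"

definition C1_seminorm :: "nat \<Rightarrow> (rvec \<Rightarrow> rvec) \<Rightarrow> ereal" where
  "C1_seminorm d f =
     (SUP (x, v)\<in>{(x, v). x \<in> Rd d \<and> v \<in> Rd d \<and> norm v = 1}. ereal (norm (Dmap d f x v)))"

definition holder_seminorm :: "nat \<Rightarrow> real \<Rightarrow> (rvec \<Rightarrow> rvec) \<Rightarrow> ereal" where
  "holder_seminorm d \<epsilon> f =
     (SUP (x, y)\<in>{(x, y). x \<in> Rd d \<and> y \<in> Rd d \<and> x \<noteq> y}.
        op_norm d (\<lambda>v. Dmap d f x v - Dmap d f y v) / ereal (norm (x - y) powr \<epsilon>))"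

definition C1_holder_map :: "nat \<Rightarrow> real \<Rightarrow> (rvec \<Rightarrow> rvec) \<Rightarrow> bool" where
  "C1_holder_map d \<epsilon> f \<longleftrightarrow> C1_map d f \<and> holder_seminorm d \<epsilon> f < \<infinity>"


section \<open>Curves\<close>

text \<open>Derivatives at the endpoints of the parameter interval are one-sided.\<close>

definition curve_deriv :: "(real \<Rightarrow> rvec) \<Rightarrow> real \<Rightarrow> real \<Rightarrow> real \<Rightarrow> rvec" where
  "curve_deriv c a b t = vector_derivative c (at t within {a..b})"

definition regular_C1_curve :: "nat \<Rightarrow> (real \<Rightarrow> rvec) \<Rightarrow> real \<Rightarrow> real \<Rightarrow> bool" where
  "regular_C1_curve d c a b \<longleftrightarrow> a < b \<and> c ` {a..b} \<subseteq> Rd d \<and> c differentiable_on {a..b} \<and>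
     continuous_on {a..b} (curve_deriv c a b) \<and> (\<forall>t\<in>{a..b}. curve_deriv c a b t \<noteq> 0)"

definition naturally_parameterized :: "(real \<Rightarrow> rvec) \<Rightarrow> real \<Rightarrow> real \<Rightarrow> bool" where
  "naturally_parameterized c a b \<longleftrightarrow> (\<forall>t\<in>{a..b}. norm (curve_deriv c a b t) = 1)"

definition curve_length :: "(real \<Rightarrow> rvec) \<Rightarrow> real \<Rightarrow> real \<Rightarrow> real" where
  "curve_length c a b = integral {a..b} (\<lambda>t. norm (curve_deriv c a b t))"

definition angle :: "rvec \<Rightarrow> rvec \<Rightarrow> real" where
  "angle u v = arccos (u \<bullet> v / (norm u * norm v))"

text \<open>A real supremum suffices here, since angles are bounded by \<open>pi\<close>.\<close>

definition max_angle :: "(real \<Rightarrow> rvec) \<Rightarrow> real \<Rightarrow> real \<Rightarrow> real" where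
  "max_angle c a b =
     (SUP (x, y)\<in>{a..b} \<times> {a..b}. angle (curve_deriv c a b x) (curve_deriv c a b y))"


section \<open>Compositions\<close>

primrec comp_seq :: "(nat \<Rightarrow> 'a \<Rightarrow> 'a) \<Rightarrow> nat \<Rightarrow> 'a \<Rightarrow> 'a" where
  "comp_seq f 0 = id"
| "comp_seq f (Suc i) = f (Suc i) \<circ> comp_seq f i"

end

theory Submission
  imports Defs
begin

text \<open>
  The distortion of a composition is the product of the distortions of its factors, so it
  suffices to control one map \<open>f\<close> acting on one curve \<open>c\<close> of length \<open>L\<close>, maximal angle
  \<open>\<alpha>\<close> and unit tangent vector \<open>\<tau>\<close>. The factor by which \<open>f\<close> stretches the speed at the parameter \<open>x\<close> is
  \<open>s x = norm (Dmap d f (c x) (\<tau> x))\<close>. Between two parameters this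
  factor changes because the base point moves, which costs at most \<open>C * L powr \<epsilon>\<close> by the
  Hoelder condition and since a chord is no longer than its arc, and because the direction turns,
  which costs at most \<open>C * \<alpha>\<close> since a chord of the unit circle is no longer than the angle it
  subtends. The bound on the derivative of the inverse gives \<open>s y \<ge> 1 / C\<close>, hence
  \<open>s x / s y \<le> 1 + C\<^sup>2 * (L powr \<epsilon> + \<alpha>) \<le> exp (C\<^sup>2 * (L powr \<epsilon> + \<alpha>))\<close>
  (\<open>stretch_ratio_le\<close>).

  Multiplying over the \<open>n\<close> maps turns the exponents into the two sums that are bounded by
  hypothesis, so that \<open>K = exp (C\<^sup>2 * (L\<^sub>0 + \<alpha>\<^sub>0))\<close> works for the speeds
  (\<open>speed_ratio_le\<close>). The speed of a regular curve whose speeds are comparable up to the factor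
  \<open>K\<close> lies within a factor \<open>K\<close> of any of its values, and integrating this over the two
  subintervals yields the comparison of lengths with \<open>K\<^sup>2\<close>
  (\<open>curve_length_ratio_bounds\<close>).
\<close>

section \<open>Tangent vectors of curves in a coordinate subspace\<close>

lemma inner_single_one: "x \<bullet> Poly_Mapping.single k 1 = Poly_Mapping.lookup (x :: rvec) k"
  by (subst inner_commute) (simp add: inner_poly_mapping_def)

lemma Rd_iff_inner: "x \<in> Rd d \<longleftrightarrow> (\<forall>k\<ge>d. x \<bullet> Poly_Mapping.single k 1 = 0)"
  by (auto simp: Rd_def inner_single_one in_keys_iff subset_iff not_less[symmetric])

lemma curve_deriv_eqI:
  assumes "a < b" "t \<in> {a..b}" "(c has_vector_derivative v) (at t within {a..b})"
  shows "curve_deriv c a b t = v"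
  unfolding curve_deriv_def using assms vector_derivative_within_cbox[of a b] by simp

lemma has_vector_derivative_curve_deriv:
  assumes "regular_C1_curve d c a b" "t \<in> {a..b}"
  shows "(c has_vector_derivative curve_deriv c a b t) (at t within {a..b})"
  using assms
  by (simp add: regular_C1_curve_def curve_deriv_def differentiable_on_def
      vector_derivative_works[symmetric])

text \<open>
  A coordinate that vanishes along a curve has vanishing derivative. This is what makes the
  seminorms, which see only vectors of \<open>Rd d\<close>, applicable to tangent vectors.
\<close>

lemma tangent_in_Rd:
  assumes ab: "a < b" and t: "t \<in> {a..b}" and sub: "c ` {a..b} \<subseteq> Rd d"
    and c': "(c has_vector_derivative v) (at t within {a..b})"
  shows "v \<in> Rd d"
  unfolding Rd_iff_inner
proof (intro allI impI)
  fix k assume k: "d \<le> k"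
  define e :: rvec where "e = Poly_Mapping.single k 1"
  have "((\<lambda>s. c s \<bullet> e) has_vector_derivative v \<bullet> e) (at t within {a..b})"
    by (rule bounded_linear.has_vector_derivative[OF bounded_linear_inner_left c'])
  moreover have "((\<lambda>s. c s \<bullet> e) has_vector_derivative 0) (at t within {a..b})"
  proof (rule has_vector_derivative_transform[OF t _ has_vector_derivative_const[of 0]])
    show "c s \<bullet> e = 0" if "s \<in> {a..b}" for s
      using sub k that unfolding e_def by (auto simp: Rd_iff_inner image_subset_iff)
  qed
  ultimately show "v \<bullet> Poly_Mapping.single k 1 = 0"
    using vector_derivative_unique_within_closed_interval[of a b t] ab t
    unfolding e_def by auto
qed

lemma curve_deriv_in_Rd:
  assumes "regular_C1_curve d c a b" "t \<in> {a..b}"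
  shows "curve_deriv c a b t \<in> Rd d"
  using tangent_in_Rd has_vector_derivative_curve_deriv[OF assms] assms
  unfolding regular_C1_curve_def by blast

lemma integrable_speed:
  assumes "regular_C1_curve d c a b"
  shows "(\<lambda>t. norm (curve_deriv c a b t)) integrable_on {a..b}"
  using assms
  by (intro integrable_continuous_interval continuous_on_norm) (simp add: regular_C1_curve_def)

lemma regular_C1_curve_subinterval:
  assumes c: "regular_C1_curve d c a b" and "a \<le> a'" "a' < b'" "b' \<le> b"
  shows "regular_C1_curve d c a' b'"
    and "\<And>t. t \<in> {a'..b'} \<Longrightarrow> curve_deriv c a' b' t = curve_deriv c a b t"
proof -
  have sub: "{a'..b'} \<subseteq> {a..b}" using assms by auto
  show eq: "curve_deriv c a' b' t = curve_deriv c a b t" if "t \<in> {a'..b'}" for t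
    using that sub assms has_vector_derivative_within_subset[OF
        has_vector_derivative_curve_deriv[OF c] sub]
    by (intro curve_deriv_eqI) auto
  have "continuous_on {a'..b'} (curve_deriv c a b)"
    using c sub by (auto simp: regular_C1_curve_def intro: continuous_on_subset)
  then have "continuous_on {a'..b'} (curve_deriv c a' b')"
    by (subst continuous_on_cong[where g = "curve_deriv c a b"]) (simp_all add: eq)
  then show "regular_C1_curve d c a' b'"
    using c sub eq assms unfolding regular_C1_curve_def
    by (auto intro: differentiable_on_subset)
qed

lemma chord_le_curve_length:
  assumes c: "regular_C1_curve d c a b" and x: "x \<in> {a..b}" and y: "y \<in> {a..b}"
  shows "norm (c x - c y) \<le> curve_length c a b"
  using x y
proof (induction x y rule: linorder_wlog)
  case (sym x y)
  then show ?case by (simp add: norm_minus_commute)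
next
  case (le x y)
  let ?v = "\<lambda>t. norm (curve_deriv c a b t)"
  have cont: "continuous_on {x..y} ?v"
    using c le unfolding regular_C1_curve_def
    by (intro continuous_on_norm) (auto intro: continuous_on_subset)
  define e where "e = sgn (c y - c x)"
  have "norm e \<le> 1" by (simp add: e_def norm_sgn)
  \<comment> \<open>Projecting to the direction of the chord reduces the claim to the fundamental theorem of
      calculus for real functions: the sequence space is not complete.\<close>
  have "((\<lambda>t. curve_deriv c a b t \<bullet> e) has_integral c y \<bullet> e - c x \<bullet> e) {x..y}"
  proof (rule fundamental_theorem_of_calculus)
    show "x \<le> y" by fact
    fix t assume t: "t \<in> {x..y}"
    have "(c has_vector_derivative curve_deriv c a b t) (at t within {x..y})"
      using t le by (intro has_vector_derivative_within_subset[OF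
          has_vector_derivative_curve_deriv[OF c]]) auto
    then show "((\<lambda>t. c t \<bullet> e) has_vector_derivative curve_deriv c a b t \<bullet> e)
        (at t within {x..y})"
      by (rule bounded_linear.has_vector_derivative[OF bounded_linear_inner_left])
  qed
  moreover have "(?v has_integral integral {x..y} ?v) {x..y}"
    using cont by (intro integrable_integral integrable_continuous_interval)
  moreover have "curve_deriv c a b t \<bullet> e \<le> ?v t" for t
    using norm_cauchy_schwarz[of "curve_deriv c a b t" e] \<open>norm e \<le> 1\<close>
      mult_left_mono[of "norm e" 1 "?v t"] by simp
  ultimately have "c y \<bullet> e - c x \<bullet> e \<le> integral {x..y} ?v"
    by (rule has_integral_le)
  also have "\<dots> \<le> integral {a..b} ?v"
    using le integrable_continuous_interval[OF cont] integrable_speed[OF c]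
    by (intro integral_subset_le) auto
  also have "c y \<bullet> e - c x \<bullet> e = norm (c y - c x)"
    unfolding e_def inner_diff_left[symmetric] sgn_div_norm
    by (cases "c y = c x") (simp_all add: dot_square_norm power2_eq_square)
  finally show ?case
    by (simp add: curve_length_def norm_minus_commute)
qed


section \<open>Angles\<close>

lemma normalized_inner_bounds:
  fixes u v :: "'a :: real_inner"
  shows "\<bar>u \<bullet> v / (norm u * norm v)\<bar> \<le> 1"
proof (cases "u = 0 \<or> v = 0")
  case False
  then have "0 < norm u * norm v" by simp
  then show ?thesis
    using Cauchy_Schwarz_ineq2[of u v] by (simp add: abs_mult)
qed auto

text \<open>A chord of the unit circle is no longer than the arc between its end points.\<close>

lemma chord_le_angle:
  assumes "u \<noteq> 0" "v \<noteq> 0"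
  shows "norm (sgn u - sgn v) \<le> angle u v"
proof -
  let ?\<theta> = "angle u v"
  have cos: "cos ?\<theta> = u \<bullet> v / (norm u * norm v)" and nn: "0 \<le> ?\<theta>"
    using normalized_inner_bounds[of u v] arccos_lbound unfolding angle_def abs_le_iff
    by (auto intro!: cos_arccos arccos_lbound)
  have "sgn u \<bullet> sgn u = 1" "sgn v \<bullet> sgn v = 1"
    using assms by (simp_all add: dot_square_norm norm_sgn)
  then have "(norm (sgn u - sgn v))\<^sup>2 = 2 - 2 * (sgn u \<bullet> sgn v)"
    by (simp add: power2_norm_eq_inner inner_diff_left inner_diff_right inner_commute)
  also have "sgn u \<bullet> sgn v = cos ?\<theta>"
    by (simp add: cos sgn_div_norm field_simps)
  also have "2 - 2 * cos ?\<theta> = (2 * sin (?\<theta> / 2))\<^sup>2"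
    using cos_double_sin[of "?\<theta> / 2"] by (simp add: power2_eq_square)
  also have "\<dots> \<le> ?\<theta>\<^sup>2"
    using abs_sin_x_le_abs_x[of "?\<theta> / 2"] nn by (intro power2_le_iff_abs_le[THEN iffD2]) auto
  finally show ?thesis
    using nn by (rule power2_le_imp_le)
qed

lemma angle_le_max_angle:
  assumes "x \<in> {a..b}" "y \<in> {a..b}"
  shows "angle (curve_deriv c a b x) (curve_deriv c a b y) \<le> max_angle c a b"
proof -
  have "angle u v \<le> pi" for u v
    using normalized_inner_bounds[of u v] unfolding angle_def abs_le_iff
    by (auto intro!: arccos_ubound)
  then have "bdd_above ((\<lambda>(x, y). angle (curve_deriv c a b x) (curve_deriv c a b y)) `
      ({a..b} \<times> {a..b}))"
    by (intro bdd_aboveI[of _ pi]) auto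
  then show ?thesis
    using assms cSUP_upper[of "(x, y)" "{a..b} \<times> {a..b}"
        "\<lambda>(x, y). angle (curve_deriv c a b x) (curve_deriv c a b y)"]
    unfolding max_angle_def by auto
qed


section \<open>Derivative bounds for maps\<close>

lemma has_derivative_Dmap:
  assumes "C1_map d f" "x \<in> Rd d"
  shows "(f has_derivative Dmap d f x) (at x within Rd d)"
  using assms unfolding C1_map_def differentiable_on_def Dmap_def
  by (simp add: frechet_derivative_works[symmetric])

lemma linear_Dmap:
  assumes "C1_map d f" "x \<in> Rd d"
  shows "linear (Dmap d f x)"
  using has_derivative_Dmap[OF assms] by (rule has_derivative_linear)

lemma sgn_in_Rd: "v \<in> Rd d \<Longrightarrow> sgn v \<in> Rd d"
  by (simp add: sgn_div_norm subspace_scale[OF subspace_Rd])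

lemma linear_norm_le_of_sgn:
  assumes "linear A" "v \<noteq> 0 \<Longrightarrow> norm (A (sgn v)) \<le> B"
  shows "norm (A v) \<le> B * norm v"
proof (cases "v = 0")
  case False
  then have "A v = norm v *\<^sub>R A (sgn v)"
    by (simp add: linear_scale[OF assms(1), symmetric] sgn_div_norm)
  then show ?thesis
    using mult_left_mono[OF assms(2)[OF False], of "norm v"] by (simp add: mult.commute)
qed (use linear_0[OF assms(1)] in simp)

lemma norm_Dmap_le:
  assumes f: "C1_map d f" and C: "C1_seminorm d f \<le> ereal C" and x: "x \<in> Rd d" and v: "v \<in> Rd d"
  shows "norm (Dmap d f x v) \<le> C * norm v"
proof (rule linear_norm_le_of_sgn[OF linear_Dmap[OF f x]])
  assume "v \<noteq> 0"
  then have "ereal (norm (Dmap d f x (sgn v))) \<le> C1_seminorm d f"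
    unfolding C1_seminorm_def using x sgn_in_Rd[OF v]
    by (intro SUP_upper2[of "(x, sgn v)"]) (auto simp: norm_sgn)
  then show "norm (Dmap d f x (sgn v)) \<le> C"
    using C by (metis ereal_less_eq(3) order_trans)
qed

lemma norm_Dmap_diff_le:
  assumes f: "C1_map d f" and C: "holder_seminorm d \<epsilon> f \<le> ereal C"
    and x: "x \<in> Rd d" and y: "y \<in> Rd d" and v: "v \<in> Rd d"
  shows "norm (Dmap d f x v - Dmap d f y v) \<le> C * norm (x - y) powr \<epsilon> * norm v"
proof (cases "x = y")
  case False
  let ?r = "norm (x - y) powr \<epsilon>"
  have r: "0 < ?r" using False by simp
  show ?thesis
  proof (rule linear_norm_le_of_sgn[where A = "\<lambda>v. Dmap d f x v - Dmap d f y v"])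
    show "linear (\<lambda>v. Dmap d f x v - Dmap d f y v)"
      by (intro linear_compose_sub linear_Dmap f x y)
    assume "v \<noteq> 0"
    then have "ereal (norm (Dmap d f x (sgn v) - Dmap d f y (sgn v))) \<le>
        op_norm d (\<lambda>v. Dmap d f x v - Dmap d f y v)"
      unfolding op_norm_def using sgn_in_Rd[OF v] by (intro SUP_upper) (auto simp: norm_sgn)
    moreover have "op_norm d (\<lambda>v. Dmap d f x v - Dmap d f y v) / ereal ?r \<le> holder_seminorm d \<epsilon> f"
      unfolding holder_seminorm_def using x y False by (intro SUP_upper2[of "(x, y)"]) auto
    ultimately have "ereal (norm (Dmap d f x (sgn v) - Dmap d f y (sgn v))) / ereal ?r \<le> ereal C"
      using C r by (meson ereal_divide_right_mono ereal_less(2) order_trans)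
    then show "norm (Dmap d f x (sgn v) - Dmap d f y (sgn v)) \<le> C * ?r"
      using r by (simp add: field_simps)
  qed
qed simp


section \<open>One map acting on a curve\<close>

lemma curve_deriv_comp:
  assumes f: "C1_map d f" and c: "regular_C1_curve d c a b" and t: "t \<in> {a..b}"
  shows "(f \<circ> c has_vector_derivative Dmap d f (c t) (curve_deriv c a b t)) (at t within {a..b})"
    and "curve_deriv (f \<circ> c) a b t = Dmap d f (c t) (curve_deriv c a b t)"
proof -
  have sub: "c ` {a..b} \<subseteq> Rd d" using c by (simp add: regular_C1_curve_def)
  then have "(f has_derivative Dmap d f (c t)) (at (c t) within c ` {a..b})"
    using t by (intro has_derivative_subset[OF has_derivative_Dmap[OF f]]) auto
  then show *: "(f \<circ> c has_vector_derivative Dmap d f (c t) (curve_deriv c a b t))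
      (at t within {a..b})"
    by (rule vector_derivative_diff_chain_within[OF has_vector_derivative_curve_deriv[OF c t]])
  show "curve_deriv (f \<circ> c) a b t = Dmap d f (c t) (curve_deriv c a b t)"
    using c t by (intro curve_deriv_eqI *) (auto simp: regular_C1_curve_def)
qed

text \<open>
  Recovering \<open>c\<close> from \<open>f \<circ> c\<close> through the inverse map bounds the stretching from below.
\<close>

lemma speed_le_comp:
  assumes f: "C1_map d f" and inj: "inj_on f (Rd d)"
    and g: "C1_map d (inv_into (Rd d) f)" and C: "C1_seminorm d (inv_into (Rd d) f) \<le> ereal C"
    and c: "regular_C1_curve d c a b" and t: "t \<in> {a..b}"
  shows "norm (curve_deriv c a b t) \<le> C * norm (curve_deriv (f \<circ> c) a b t)"
proof -
  let ?g = "inv_into (Rd d) f" and ?w = "curve_deriv (f \<circ> c) a b t"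
  have ab: "a < b" and sub: "c ` {a..b} \<subseteq> Rd d"
    using c by (simp_all add: regular_C1_curve_def)
  have sub': "(f \<circ> c) ` {a..b} \<subseteq> Rd d"
    using f sub by (auto simp: C1_map_def)
  then have fct: "f (c t) \<in> Rd d"
    using t by auto
  have w: "(f \<circ> c has_vector_derivative ?w) (at t within {a..b})"
    using curve_deriv_comp[OF f c t] by simp
  have "(?g has_derivative Dmap d ?g (f (c t))) (at ((f \<circ> c) t) within (f \<circ> c) ` {a..b})"
    using has_derivative_subset[OF has_derivative_Dmap[OF g fct] sub'] by simp
  from vector_derivative_diff_chain_within[OF w this]
  have "(?g \<circ> (f \<circ> c) has_vector_derivative Dmap d ?g (f (c t)) ?w) (at t within {a..b})" .
  then have "(c has_vector_derivative Dmap d ?g (f (c t)) ?w) (at t within {a..b})"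
    by (rule has_vector_derivative_transform[OF t, rotated])
      (use inj sub in \<open>auto simp: image_subset_iff\<close>)
  then have "curve_deriv c a b t = Dmap d ?g (f (c t)) ?w"
    by (rule curve_deriv_eqI[OF ab t])
  then show ?thesis
    using norm_Dmap_le[OF g C fct tangent_in_Rd[OF ab t sub' w]] by simp
qed

text \<open>
  The change of the tangent vector splits into the part caused by the motion of the base point and
  the part caused by the change of the vector that the derivative is applied to. This estimate
  serves twice: applied to nearby parameters it gives the continuity of the new tangent vector, and
  applied to unit vectors it controls the stretching.
\<close>

lemma norm_Dmap_change_le:
  assumes "C1_map d f" "C1_seminorm d f \<le> ereal C" "holder_seminorm d \<epsilon> f \<le> ereal C"
    and "p \<in> Rd d" "q \<in> Rd d" "v \<in> Rd d" "w \<in> Rd d"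
  shows "norm (Dmap d f p v - Dmap d f q w)
    \<le> C * norm (p - q) powr \<epsilon> * norm v + C * norm (v - w)"
proof -
  have "Dmap d f p v - Dmap d f q w = (Dmap d f p v - Dmap d f q v) + Dmap d f q (v - w)"
    using linear_diff[OF linear_Dmap[of d f q]] assms by simp
  then have "norm (Dmap d f p v - Dmap d f q w)
      \<le> norm (Dmap d f p v - Dmap d f q v) + norm (Dmap d f q (v - w))"
    by (metis norm_triangle_ineq)
  also have "\<dots> \<le> C * norm (p - q) powr \<epsilon> * norm v + C * norm (v - w)"
    using assms
    by (intro add_mono norm_Dmap_diff_le norm_Dmap_le subspace_diff[OF subspace_Rd])
  finally show ?thesis .
qed

lemma regular_C1_curve_comp:
  assumes \<epsilon>: "0 < \<epsilon>"
    and f: "C1_map d f" "C1_seminorm d f \<le> ereal C" "holder_seminorm d \<epsilon> f \<le> ereal C"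
    and inj: "inj_on f (Rd d)"
    and g: "C1_map d (inv_into (Rd d) f)" "C1_seminorm d (inv_into (Rd d) f) \<le> ereal C"
    and c: "regular_C1_curve d c a b"
  shows "regular_C1_curve d (f \<circ> c) a b"
proof -
  let ?v = "curve_deriv c a b"
  have ab: "a < b" and sub: "c ` {a..b} \<subseteq> Rd d" and nz: "\<And>t. t \<in> {a..b} \<Longrightarrow> ?v t \<noteq> 0"
    and cont_v: "continuous_on {a..b} ?v" and cont_c: "continuous_on {a..b} c"
    using c by (auto simp: regular_C1_curve_def differentiable_imp_continuous_on)
  have "continuous_on {a..b} (\<lambda>t. Dmap d f (c t) (?v t))"
    unfolding continuous_on_def
  proof
    fix s assume s: "s \<in> {a..b}"
    have c_lim: "(c \<longlongrightarrow> c s) (at s within {a..b})" and v_lim: "(?v \<longlongrightarrow> ?v s) (at s within {a..b})"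
      using s cont_c cont_v by (auto simp: continuous_on_def)
    let ?B = "\<lambda>t. C * norm (c t - c s) powr \<epsilon> * norm (?v t) + C * norm (?v t - ?v s)"
    have dist_lim: "((\<lambda>t. norm (c t - c s) powr \<epsilon>) \<longlongrightarrow> norm (c s - c s) powr \<epsilon>) (at s within {a..b})"
      using \<epsilon> by (intro tendsto_powr' tendsto_intros c_lim) auto
    have "(?B \<longlongrightarrow> C * norm (c s - c s) powr \<epsilon> * norm (?v s) + C * norm (?v s - ?v s))
        (at s within {a..b})"
      by (rule tendsto_add[OF tendsto_mult[OF tendsto_mult_left[OF dist_lim] tendsto_norm[OF v_lim]]
            tendsto_mult_left[OF tendsto_norm[OF tendsto_diff[OF v_lim tendsto_const]]]])
    then have lim: "(?B \<longlongrightarrow> 0) (at s within {a..b})"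
      by simp
    have le: "norm (Dmap d f (c t) (?v t) - Dmap d f (c s) (?v s)) \<le> ?B t"
      if "t \<in> {a..b}" for t
      using that s sub by (intro norm_Dmap_change_le f curve_deriv_in_Rd[OF c]) auto
    have "\<forall>\<^sub>F t in at s within {a..b}. norm (Dmap d f (c t) (?v t) - Dmap d f (c s) (?v s)) \<le> ?B t"
      unfolding eventually_at_filter by (rule always_eventually) (simp add: le)
    from this lim
    have "((\<lambda>t. Dmap d f (c t) (?v t) - Dmap d f (c s) (?v s)) \<longlongrightarrow> 0) (at s within {a..b})"
      by (rule Lim_null_comparison)
    then show "((\<lambda>t. Dmap d f (c t) (?v t)) \<longlongrightarrow> Dmap d f (c s) (?v s)) (at s within {a..b})"
      by (rule Lim_null[THEN iffD2])
  qed
  then have "continuous_on {a..b} (curve_deriv (f \<circ> c) a b)"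
    by (subst continuous_on_cong[where g = "\<lambda>t. Dmap d f (c t) (?v t)"])
      (simp_all add: curve_deriv_comp(2)[OF f(1) c])
  moreover have "curve_deriv (f \<circ> c) a b t \<noteq> 0" if "t \<in> {a..b}" for t
    using speed_le_comp[OF f(1) inj g c that] nz[OF that] by auto
  moreover have "f \<circ> c differentiable_on {a..b}"
    using curve_deriv_comp(1)[OF f(1) c]
    unfolding differentiable_on_def has_vector_derivative_def differentiable_def by blast
  ultimately show ?thesis
    using ab sub f(1) by (auto simp: regular_C1_curve_def C1_map_def)
qed

lemma stretch_ratio_le:
  assumes \<epsilon>: "0 < \<epsilon>" and C: "0 < C"
    and f: "C1_map d f" "C1_seminorm d f \<le> ereal C" "holder_seminorm d \<epsilon> f \<le> ereal C"
    and inj: "inj_on f (Rd d)"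
    and g: "C1_map d (inv_into (Rd d) f)" "C1_seminorm d (inv_into (Rd d) f) \<le> ereal C"
    and c: "regular_C1_curve d c a b" and x: "x \<in> {a..b}" and y: "y \<in> {a..b}"
  shows "norm (curve_deriv (f \<circ> c) a b x) / norm (curve_deriv c a b x) \<le>
    exp (C\<^sup>2 * (curve_length c a b powr \<epsilon> + max_angle c a b)) *
      (norm (curve_deriv (f \<circ> c) a b y) / norm (curve_deriv c a b y))"
proof -
  let ?v = "curve_deriv c a b"
  let ?E = "curve_length c a b powr \<epsilon> + max_angle c a b"
  define s where "s t = norm (curve_deriv (f \<circ> c) a b t) / norm (?v t)" for t
  have sub: "c ` {a..b} \<subseteq> Rd d" and nz: "\<And>t. t \<in> {a..b} \<Longrightarrow> ?v t \<noteq> 0"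
    using c by (auto simp: regular_C1_curve_def)
  have s_eq: "s t = norm (Dmap d f (c t) (sgn (?v t)))" if "t \<in> {a..b}" for t
    using linear_scale[OF linear_Dmap[OF f(1)], of "c t" "inverse (norm (?v t))" "?v t"] sub that
    by (auto simp: s_def curve_deriv_comp(2)[OF f(1) c that] sgn_div_norm divide_inverse_commute
        image_subset_iff)
  have "s x - s y \<le> norm (Dmap d f (c x) (sgn (?v x)) - Dmap d f (c y) (sgn (?v y)))"
    using x y by (simp add: s_eq norm_triangle_ineq2)
  also have "\<dots> \<le> C * norm (c x - c y) powr \<epsilon> * norm (sgn (?v x)) + C * norm (sgn (?v x) - sgn (?v y))"
    using x y sub by (intro norm_Dmap_change_le f sgn_in_Rd curve_deriv_in_Rd[OF c]) auto
  also have "\<dots> = C * (norm (c x - c y) powr \<epsilon> + norm (sgn (?v x) - sgn (?v y)))"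
    using nz[OF x] by (simp add: norm_sgn distrib_left)
  also have "\<dots> \<le> C * ?E"
    using C \<epsilon> chord_le_curve_length[OF c x y] chord_le_angle[OF nz[OF x] nz[OF y]]
      angle_le_max_angle[OF x y, of c]
    by (intro mult_left_mono add_mono powr_mono2) auto
  finally have diff: "s x - s y \<le> C * ?E" .
  have "1 \<le> C * s y"
    using speed_le_comp[OF f(1) inj g c y] nz[OF y] by (simp add: s_def field_simps)
  moreover have E: "0 \<le> ?E"
    using chord_le_angle[OF nz[OF x] nz[OF y]] angle_le_max_angle[OF x y, of c]
    by (smt (verit) norm_ge_zero powr_ge_zero)
  ultimately have "C * ?E \<le> C * ?E * (C * s y)"
    using C mult_left_mono[of 1 "C * s y" "C * ?E"] by simp
  then have "s x \<le> (1 + C\<^sup>2 * ?E) * s y"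
    using diff by (simp add: algebra_simps power2_eq_square)
  also have "\<dots> \<le> exp (C\<^sup>2 * ?E) * s y"
    by (intro mult_right_mono exp_ge_add_one_self) (simp add: s_def)
  finally show ?thesis
    by (simp add: s_def)
qed


section \<open>Compositions of maps\<close>

lemma regular_C1_curve_comp_seq:
  assumes \<epsilon>: "0 < \<epsilon>"
    and f: "\<And>i. i \<in> {1..n} \<Longrightarrow> C1_map d (f i)"
      "\<And>i. i \<in> {1..n} \<Longrightarrow> C1_seminorm d (f i) \<le> ereal C"
      "\<And>i. i \<in> {1..n} \<Longrightarrow> holder_seminorm d \<epsilon> (f i) \<le> ereal C"
      "\<And>i. i \<in> {1..n} \<Longrightarrow> inj_on (f i) (Rd d)"
      "\<And>i. i \<in> {1..n} \<Longrightarrow> C1_map d (inv_into (Rd d) (f i))"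
      "\<And>i. i \<in> {1..n} \<Longrightarrow> C1_seminorm d (inv_into (Rd d) (f i)) \<le> ereal C"
    and c: "regular_C1_curve d c a b"
  shows "m \<le> n \<Longrightarrow> regular_C1_curve d (comp_seq f m \<circ> c) a b"
proof (induction m)
  case (Suc m)
  then have m: "Suc m \<in> {1..n}"
    by simp
  have IH: "regular_C1_curve d (comp_seq f m \<circ> c) a b"
    using Suc.prems by (intro Suc.IH) simp
  have "regular_C1_curve d (f (Suc m) \<circ> (comp_seq f m \<circ> c)) a b"
    by (rule regular_C1_curve_comp[OF \<epsilon> f[OF m] IH])
  then show ?case by (simp only: comp_seq.simps comp_assoc)
qed (use c in simp)

lemma speed_ratio_le:
  assumes \<epsilon>: "0 < \<epsilon>" and C: "0 < C"
    and f: "\<And>i. i \<in> {1..n} \<Longrightarrow> C1_map d (f i)"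
      "\<And>i. i \<in> {1..n} \<Longrightarrow> C1_seminorm d (f i) \<le> ereal C"
      "\<And>i. i \<in> {1..n} \<Longrightarrow> holder_seminorm d \<epsilon> (f i) \<le> ereal C"
      "\<And>i. i \<in> {1..n} \<Longrightarrow> inj_on (f i) (Rd d)"
      "\<And>i. i \<in> {1..n} \<Longrightarrow> C1_map d (inv_into (Rd d) (f i))"
      "\<And>i. i \<in> {1..n} \<Longrightarrow> C1_seminorm d (inv_into (Rd d) (f i)) \<le> ereal C"
    and c: "regular_C1_curve d c a b" and x: "x \<in> {a..b}" and y: "y \<in> {a..b}"
  shows "norm (curve_deriv (comp_seq f n \<circ> c) a b x) / norm (curve_deriv c a b x) \<le>
    exp (C\<^sup>2 * ((\<Sum>i<n. curve_length (comp_seq f i \<circ> c) a b powr \<epsilon>) +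
                (\<Sum>i<n. max_angle (comp_seq f i \<circ> c) a b))) *
      (norm (curve_deriv (comp_seq f n \<circ> c) a b y) / norm (curve_deriv c a b y))"
proof -
  define w where "w m t = norm (curve_deriv (comp_seq f m \<circ> c) a b t)" for m t
  define E where "E i = curve_length (comp_seq f i \<circ> c) a b powr \<epsilon> +
    max_angle (comp_seq f i \<circ> c) a b" for i
  have reg: "regular_C1_curve d (comp_seq f m \<circ> c) a b" if "m \<le> n" for m
    using regular_C1_curve_comp_seq[OF \<epsilon> f c that] .
  have pos: "0 < w m t" if "m \<le> n" "t \<in> {a..b}" for m t
    using reg[OF that(1)] that(2) by (simp add: w_def regular_C1_curve_def)
  have "w m x / w 0 x \<le> exp (C\<^sup>2 * (\<Sum>i<m. E i)) * (w m y / w 0 y)" if "m \<le> n" for m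
    using that
  proof (induction m)
    case 0
    then show ?case using pos[of 0 x] pos[of 0 y] x y by simp
  next
    case (Suc m)
    have "w (Suc m) x / w m x \<le> exp (C\<^sup>2 * E m) * (w (Suc m) y / w m y)"
      using stretch_ratio_le[of \<epsilon> C d "f (Suc m)" "comp_seq f m \<circ> c" a b x y]
        \<epsilon> C f[of "Suc m"] reg[of m] Suc.prems x y
      by (simp add: w_def E_def comp_assoc)
    moreover have "w m x / w 0 x \<le> exp (C\<^sup>2 * (\<Sum>i<m. E i)) * (w m y / w 0 y)"
      using Suc by simp
    ultimately have "w (Suc m) x / w m x * (w m x / w 0 x) \<le>
        exp (C\<^sup>2 * E m) * (w (Suc m) y / w m y) * (exp (C\<^sup>2 * (\<Sum>i<m. E i)) * (w m y / w 0 y))"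
      by (rule mult_mono) (simp_all add: w_def)
    then show ?case
      using pos[of m x] pos[of m y] x y Suc.prems by (simp add: distrib_left exp_add mult_ac)
  qed
  from this[of n] show ?thesis
    by (simp add: w_def E_def sum.distrib)
qed


section \<open>From speeds to lengths\<close>

lemma curve_length_bounds:
  assumes c: "regular_C1_curve d c a b" and sub: "a \<le> a'" "a' < b'" "b' \<le> b"
    and bnd: "\<And>t. t \<in> {a..b} \<Longrightarrow> m \<le> norm (curve_deriv c a b t) \<and> norm (curve_deriv c a b t) \<le> M"
  shows "m * (b' - a') \<le> curve_length c a' b'" "curve_length c a' b' \<le> M * (b' - a')"
proof -
  let ?s = "\<lambda>t. norm (curve_deriv c a' b' t)"
  note c' = regular_C1_curve_subinterval[OF c sub]
  have int: "(?s has_integral curve_length c a' b') {a'..b'}"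
    unfolding curve_length_def by (rule integrable_integral[OF integrable_speed[OF c'(1)]])
  have s: "m \<le> ?s t" "?s t \<le> M" if "t \<in> {a'..b'}" for t
    using bnd[of t] that sub by (auto simp: c'(2))
  show "m * (b' - a') \<le> curve_length c a' b'"
    using has_integral_le[OF has_integral_const_real[of m a' b'] int s(1)] sub by (simp add: mult.commute)
  show "curve_length c a' b' \<le> M * (b' - a')"
    using has_integral_le[OF int has_integral_const_real[of M a' b'] s(2)] sub by (simp add: mult.commute)
qed

lemma curve_length_ratio_bounds:
  assumes c: "regular_C1_curve d c a b" and K: "0 < K"
    and ratio: "\<And>x y. x \<in> {a..b} \<Longrightarrow> y \<in> {a..b} \<Longrightarrow>
      norm (curve_deriv c a b x) \<le> K * norm (curve_deriv c a b y)"
    and sub1: "a \<le> a\<^sub>1" "a\<^sub>1 < b\<^sub>1" "b\<^sub>1 \<le> b" and sub2: "a \<le> a\<^sub>2" "a\<^sub>2 < b\<^sub>2" "b\<^sub>2 \<le> b"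
  shows "(b\<^sub>1 - a\<^sub>1) / (b\<^sub>2 - a\<^sub>2) * inverse (K\<^sup>2) \<le> curve_length c a\<^sub>1 b\<^sub>1 / curve_length c a\<^sub>2 b\<^sub>2"
    and "curve_length c a\<^sub>1 b\<^sub>1 / curve_length c a\<^sub>2 b\<^sub>2 \<le> (b\<^sub>1 - a\<^sub>1) / (b\<^sub>2 - a\<^sub>2) * K\<^sup>2"
proof -
  define m where "m = norm (curve_deriv c a b a)"
  have a: "a \<in> {a..b}" and m: "0 < m"
    using c by (auto simp: m_def regular_C1_curve_def)
  have "m / K \<le> norm (curve_deriv c a b t) \<and> norm (curve_deriv c a b t) \<le> K * m"
    if "t \<in> {a..b}" for t
    using ratio[OF a that] ratio[OF that a] K by (simp add: m_def field_simps)
  note bnd = curve_length_bounds[OF c _ _ _ this]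
  note b1 = bnd[OF sub1] and b2 = bnd[OF sub2]
  have pos: "0 < m / K * (b\<^sub>1 - a\<^sub>1)" "0 < m / K * (b\<^sub>2 - a\<^sub>2)"
    using m K sub1 sub2 by auto
  have lower: "m / K * p / (K * m * q) = p / q * inverse (K\<^sup>2)"
    and upper: "K * m * p / (m / K * q) = p / q * K\<^sup>2" for p q
    using m K by (simp_all add: field_simps power2_eq_square)
  have "m / K * (b\<^sub>1 - a\<^sub>1) / (K * m * (b\<^sub>2 - a\<^sub>2)) \<le> curve_length c a\<^sub>1 b\<^sub>1 / curve_length c a\<^sub>2 b\<^sub>2"
    using b1 b2 pos by (intro frac_le) auto
  also have "m / K * (b\<^sub>1 - a\<^sub>1) / (K * m * (b\<^sub>2 - a\<^sub>2)) =
      (b\<^sub>1 - a\<^sub>1) / (b\<^sub>2 - a\<^sub>2) * inverse (K\<^sup>2)"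
    by (rule lower)
  finally show "(b\<^sub>1 - a\<^sub>1) / (b\<^sub>2 - a\<^sub>2) * inverse (K\<^sup>2) \<le> curve_length c a\<^sub>1 b\<^sub>1 / curve_length c a\<^sub>2 b\<^sub>2" .
  have "curve_length c a\<^sub>1 b\<^sub>1 / curve_length c a\<^sub>2 b\<^sub>2 \<le> K * m * (b\<^sub>1 - a\<^sub>1) / (m / K * (b\<^sub>2 - a\<^sub>2))"
    using b1 b2 pos by (intro frac_le) auto
  also have "K * m * (b\<^sub>1 - a\<^sub>1) / (m / K * (b\<^sub>2 - a\<^sub>2)) = (b\<^sub>1 - a\<^sub>1) / (b\<^sub>2 - a\<^sub>2) * K\<^sup>2"
    by (rule upper)
  finally show "curve_length c a\<^sub>1 b\<^sub>1 / curve_length c a\<^sub>2 b\<^sub>2 \<le> (b\<^sub>1 - a\<^sub>1) / (b\<^sub>2 - a\<^sub>2) * K\<^sup>2" .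
qed


section \<open>Bounded distortion\<close>

theorem theorem2:
  fixes C L\<^sub>0 \<alpha>\<^sub>0 :: real
  shows "\<exists>K>0. \<forall>(d::nat) (n::nat) (\<epsilon>::real) (\<gamma>::real \<Rightarrow> rvec) a\<^sub>0 b\<^sub>0 (f::nat \<Rightarrow> rvec \<Rightarrow> rvec).
    d \<ge> 1 \<longrightarrow> n \<ge> 1 \<longrightarrow> 0 < \<epsilon> \<longrightarrow> \<epsilon> \<le> 1 \<longrightarrow>
    regular_C1_curve d \<gamma> a\<^sub>0 b\<^sub>0 \<longrightarrow> naturally_parameterized \<gamma> a\<^sub>0 b\<^sub>0 \<longrightarrow>
    (\<forall>i\<in>{1..n}. C1_holder_map d \<epsilon> (f i) \<and> bij_betw (f i) (Rd d) (Rd d) \<and>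
       C1_map d (inv_into (Rd d) (f i))) \<longrightarrow>
    (\<forall>i\<in>{1..n}. C1_seminorm d (f i) \<le> ereal C \<and>
       C1_seminorm d (inv_into (Rd d) (f i)) \<le> ereal C \<and>
       holder_seminorm d \<epsilon> (f i) \<le> ereal C) \<longrightarrow>
    (\<Sum>i<n. curve_length (comp_seq f i \<circ> \<gamma>) a\<^sub>0 b\<^sub>0 powr \<epsilon>) \<le> L\<^sub>0 \<longrightarrow>
    (\<Sum>i<n. max_angle (comp_seq f i \<circ> \<gamma>) a\<^sub>0 b\<^sub>0) \<le> \<alpha>\<^sub>0 \<longrightarrow>
    (\<forall>x\<in>{a\<^sub>0..b\<^sub>0}. \<forall>y\<in>{a\<^sub>0..b\<^sub>0}.
       inverse K \<le> norm (curve_deriv (comp_seq f n \<circ> \<gamma>) a\<^sub>0 b\<^sub>0 x) /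
                    norm (curve_deriv (comp_seq f n \<circ> \<gamma>) a\<^sub>0 b\<^sub>0 y) \<and>
       norm (curve_deriv (comp_seq f n \<circ> \<gamma>) a\<^sub>0 b\<^sub>0 x) /
         norm (curve_deriv (comp_seq f n \<circ> \<gamma>) a\<^sub>0 b\<^sub>0 y) \<le> K) \<and>
    (\<forall>a\<^sub>1 b\<^sub>1 a\<^sub>2 b\<^sub>2.
       a\<^sub>0 \<le> a\<^sub>1 \<longrightarrow> a\<^sub>1 < b\<^sub>1 \<longrightarrow> b\<^sub>1 \<le> b\<^sub>0 \<longrightarrow> a\<^sub>0 \<le> a\<^sub>2 \<longrightarrow> a\<^sub>2 < b\<^sub>2 \<longrightarrow> b\<^sub>2 \<le> b\<^sub>0 \<longrightarrow>
       \<bar>b\<^sub>1 - a\<^sub>1\<bar> / \<bar>b\<^sub>2 - a\<^sub>2\<bar> * inverse (K\<^sup>2) \<le>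
         curve_length (comp_seq f n \<circ> \<gamma>) a\<^sub>1 b\<^sub>1 / curve_length (comp_seq f n \<circ> \<gamma>) a\<^sub>2 b\<^sub>2 \<and>
       curve_length (comp_seq f n \<circ> \<gamma>) a\<^sub>1 b\<^sub>1 / curve_length (comp_seq f n \<circ> \<gamma>) a\<^sub>2 b\<^sub>2 \<le>
         \<bar>b\<^sub>1 - a\<^sub>1\<bar> / \<bar>b\<^sub>2 - a\<^sub>2\<bar> * K\<^sup>2)"
proof -
  define K where "K = exp (C\<^sup>2 * (L\<^sub>0 + \<alpha>\<^sub>0))"
  have K: "0 < K" by (simp add: K_def)
  show ?thesis
  proof (rule exI[of _ K], rule conjI[OF K], intro allI impI)
    fix d n :: nat and \<epsilon> :: real and \<gamma> :: "real \<Rightarrow> rvec" and a b :: real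
      and f :: "nat \<Rightarrow> rvec \<Rightarrow> rvec"
    assume n: "1 \<le> n" and \<epsilon>: "0 < \<epsilon>"
      and \<gamma>: "regular_C1_curve d \<gamma> a b" and nat: "naturally_parameterized \<gamma> a b"
      and maps: "\<forall>i\<in>{1..n}. C1_holder_map d \<epsilon> (f i) \<and> bij_betw (f i) (Rd d) (Rd d) \<and>
        C1_map d (inv_into (Rd d) (f i))"
      and bounds: "\<forall>i\<in>{1..n}. C1_seminorm d (f i) \<le> ereal C \<and>
        C1_seminorm d (inv_into (Rd d) (f i)) \<le> ereal C \<and> holder_seminorm d \<epsilon> (f i) \<le> ereal C"
      and L: "(\<Sum>i<n. curve_length (comp_seq f i \<circ> \<gamma>) a b powr \<epsilon>) \<le> L\<^sub>0"
      and \<alpha>: "(\<Sum>i<n. max_angle (comp_seq f i \<circ> \<gamma>) a b) \<le> \<alpha>\<^sub>0"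
    have f: "C1_map d (f i)" "C1_seminorm d (f i) \<le> ereal C" "holder_seminorm d \<epsilon> (f i) \<le> ereal C"
        "inj_on (f i) (Rd d)" "C1_map d (inv_into (Rd d) (f i))"
        "C1_seminorm d (inv_into (Rd d) (f i)) \<le> ereal C" if "i \<in> {1..n}" for i
      using maps bounds that by (auto simp: C1_holder_map_def bij_betw_def)
    have unit: "norm (curve_deriv \<gamma> a b t) = 1" if "t \<in> {a..b}" for t
      using nat that by (simp add: naturally_parameterized_def)
    have a: "a \<in> {a..b}" using \<gamma> by (simp add: regular_C1_curve_def)
    \<comment> \<open>\<open>C\<close> is an arbitrary real; that \<open>f 1\<close> has an inverse whose derivative is bounded by \<open>C\<close>
        forces it to be positive.\<close>
    have "1 \<le> C * norm (curve_deriv (f 1 \<circ> \<gamma>) a b a)"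
      using speed_le_comp[OF _ _ _ _ \<gamma> a, of "f 1" C] f[of 1] n unit[OF a] by simp
    then have C: "0 < C"
      by (smt (verit) mult_nonpos_nonneg norm_ge_zero)
    let ?c = "comp_seq f n \<circ> \<gamma>"
    let ?s = "\<lambda>t. norm (curve_deriv ?c a b t)"
    have reg: "regular_C1_curve d ?c a b"
      using regular_C1_curve_comp_seq[OF \<epsilon> f \<gamma> order_refl] .
    have ratio: "?s x \<le> K * ?s y" if "x \<in> {a..b}" "y \<in> {a..b}" for x y
    proof -
      have "?s x \<le> exp (C\<^sup>2 * ((\<Sum>i<n. curve_length (comp_seq f i \<circ> \<gamma>) a b powr \<epsilon>) +
          (\<Sum>i<n. max_angle (comp_seq f i \<circ> \<gamma>) a b))) * ?s y"
        using speed_ratio_le[OF \<epsilon> C f \<gamma> that] unit that by simp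
      also have "\<dots> \<le> K * ?s y"
        unfolding K_def using L \<alpha>
        by (intro mult_right_mono exp_le_cancel_iff[THEN iffD2] mult_left_mono add_mono) auto
      finally show ?thesis .
    qed
    have pos: "0 < ?s t" if "t \<in> {a..b}" for t
      using reg that by (simp add: regular_C1_curve_def)
    show "(\<forall>x\<in>{a..b}. \<forall>y\<in>{a..b}. inverse K \<le> ?s x / ?s y \<and> ?s x / ?s y \<le> K) \<and>
      (\<forall>a\<^sub>1 b\<^sub>1 a\<^sub>2 b\<^sub>2.
        a \<le> a\<^sub>1 \<longrightarrow> a\<^sub>1 < b\<^sub>1 \<longrightarrow> b\<^sub>1 \<le> b \<longrightarrow> a \<le> a\<^sub>2 \<longrightarrow> a\<^sub>2 < b\<^sub>2 \<longrightarrow> b\<^sub>2 \<le> b \<longrightarrow>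
        \<bar>b\<^sub>1 - a\<^sub>1\<bar> / \<bar>b\<^sub>2 - a\<^sub>2\<bar> * inverse (K\<^sup>2) \<le> curve_length ?c a\<^sub>1 b\<^sub>1 / curve_length ?c a\<^sub>2 b\<^sub>2 \<and>
        curve_length ?c a\<^sub>1 b\<^sub>1 / curve_length ?c a\<^sub>2 b\<^sub>2 \<le> \<bar>b\<^sub>1 - a\<^sub>1\<bar> / \<bar>b\<^sub>2 - a\<^sub>2\<bar> * K\<^sup>2)"
    proof (intro conjI ballI allI impI)
      fix x y assume xy: "x \<in> {a..b}" "y \<in> {a..b}"
      show "?s x / ?s y \<le> K"
        using ratio[OF xy] pos[OF xy(2)] by (simp add: divide_le_eq)
      show "inverse K \<le> ?s x / ?s y"
        using ratio[OF xy(2,1)] pos[OF xy(2)] K by (simp add: field_simps)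
    next
      fix a\<^sub>1 b\<^sub>1 a\<^sub>2 b\<^sub>2
      assume "a \<le> a\<^sub>1" "a\<^sub>1 < b\<^sub>1" "b\<^sub>1 \<le> b" "a \<le> a\<^sub>2" "a\<^sub>2 < b\<^sub>2" "b\<^sub>2 \<le> b"
      note * = this curve_length_ratio_bounds[OF reg K ratio this]
      show "\<bar>b\<^sub>1 - a\<^sub>1\<bar> / \<bar>b\<^sub>2 - a\<^sub>2\<bar> * inverse (K\<^sup>2) \<le> curve_length ?c a\<^sub>1 b\<^sub>1 / curve_length ?c a\<^sub>2 b\<^sub>2"
        using * by (simp only: abs_of_pos diff_gt_0_iff_gt)
      show "curve_length ?c a\<^sub>1 b\<^sub>1 / curve_length ?c a\<^sub>2 b\<^sub>2 \<le> \<bar>b\<^sub>1 - a\<^sub>1\<bar> / \<bar>b\<^sub>2 - a\<^sub>2\<bar> * K\<^sup>2"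
        using * by (simp only: abs_of_pos diff_gt_0_iff_gt)
    qed
  qed
qed


end
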